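(* Let $A=\{0,1,\dots,m\}$ with $m\ge 1$ and fix $n\ge 1$. Let $u_1<_{\text{lex}}u_2<_{\text{lex}}\cdots<_{\text{lex}}u_k$ be all Nyldon words of length at most $n$, and define $Y_1=A$ and $Y_i=(Y_{i-1}\setminus\{u_{i-1}\})u_{i-1}^*$ for $2\le i\le k$. Then for each $1\le i\le k$, the set $Y_i$ is a code and $$\sum_{y\in Y_i}(m+1)^{-|y|}=1.$$
   Context: $A=\{0,1,\dots,m\}$ is ordered $0<1<\cdots<m$. The lexicographic order $<_{\text{lex}}$ on $A^*$: $u<_{\text{lex}}v$ if $u$ is a proper prefix of $v$, or there are a word $p$ and letters $i<j$ with $pi$ a prefix of $u$ and $pj$ a prefix of $v$. Nyldon words are defined recursively: a nonempty word $w$ is Nyldon if $w$ is a single letter, or $w$ cannot be written as $w=w_1w_2\cdots w_k$ with $k\ge 2$, each $w_i$ Nyldon, and $w_1\le_{\text{lex}}w_2\le_{\text{lex}}\cdots\le_{\text{lex}}w_k$. For a set $X$ of words and a word $u$, $Xu^*=\bigcup_{j\ge 0}\{xu^j:x\in X\}$. It is known that $u_i\in Y_i$ for all $i$ (the Nyldon words form a right Lazard set). A set $F\subseteq A^*$ is a code if any two sequences of words of $F$ with the same concatenation are identical. *)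

theory Defs
  imports "HOL-Analysis.Analysis" "HOL-Library.List_Lexorder"
begin

text \<open>
  Words are lists, and \<open>\<le>\<close>, \<open><\<close> on words are the lexicographic order of \<open>List_Lexorder\<close>, in which a
  proper prefix of a word is smaller than the word. The alphabet is not a parameter of \<open>nyldon\<close>,
  since the factors of a word only use letters of that word. The condition \<open>v \<noteq> []\<close> is redundant
  (Nyldon words are nonempty, cf. \<open>nyldon_iff\<close>); it only serves to justify the recursion.
\<close>

context
  notes conj_cong [fundef_cong]
begin

function nyldon :: "'a::linorder list \<Rightarrow> bool" where
  "nyldon w \<longleftrightarrow> w \<noteq> [] \<and>
     (length w = 1 \<or>
      \<not> (\<exists>ws. length ws \<ge> 2 \<and> concat ws = w \<and> (\<forall>v\<in>set ws. v \<noteq> []) \<and>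
             (\<forall>v\<in>set ws. nyldon v) \<and> sorted ws))"
  by pat_completeness auto
termination
proof (relation "Wellfounded.measure length")
  fix w v :: "'a list" and ws :: "'a list list"
  assume len: "2 \<le> length ws" and w: "concat ws = w"
    and ne: "\<forall>v\<in>set ws. v \<noteq> []" and v: "v \<in> set ws"
  obtain xs ys where ws: "ws = xs @ v # ys"
    using split_list[OF v] by blast
  with len obtain x where "x \<in> set xs \<union> set ys"
    by (cases xs; cases ys) auto
  with ne ws have "concat xs \<noteq> [] \<or> concat ys \<noteq> []"
    by auto
  then have "length v < length w"
    using w ws by (auto simp flip: length_greater_0_conv)
  then show "(v, w) \<in> Wellfounded.measure length" by simp
qed simp

end

declare nyldon.simps [simp del]

lemma nyldon_iff:
  "nyldon w \<longleftrightarrow> w \<noteq> [] \<and>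
     (length w = 1 \<or>
      \<not> (\<exists>ws. length ws \<ge> 2 \<and> concat ws = w \<and> (\<forall>v\<in>set ws. nyldon v) \<and> sorted ws))"
proof -
  have "nyldon v \<Longrightarrow> v \<noteq> []" for v :: "'a list"
    by (subst (asm) nyldon.simps) blast
  then show ?thesis
    by (subst nyldon.simps) blast
qed

definition append_star :: "'a list set \<Rightarrow> 'a list \<Rightarrow> 'a list set" where
  "append_star X u = (\<Union>j. {x @ concat (replicate j u) | x. x \<in> X})"

definition is_code :: "'a list set \<Rightarrow> bool" where
  "is_code F \<longleftrightarrow> (\<forall>xs\<in>lists F. \<forall>ys\<in>lists F. concat xs = concat ys \<longrightarrow> xs = ys)"

end

theory Submission
  imports Defs
begin

text \<open>
  Starting from the letters, repeatedly eliminate the least word \<open>v\<close> of length at most \<open>n\<close> from the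
  current code \<open>Z\<close>, replacing \<open>Z\<close> by \<open>(Z - {v}) v\<^sup>*\<close>. Since appending letters increases a word, the
  eliminated words increase, so the procedure stops with a code without words of length at most \<open>n\<close>.
  Each step splits a word of \<open>Z\<^sup>*\<close> uniquely as a power of \<open>v\<close> followed by a product over the
  new code, hence every word of length at most \<open>n\<close> is uniquely a nondecreasing product of eliminated
  words. By induction on the length this forces the eliminated words to be the Nyldon words, so the
  procedure produces exactly the sets \<open>Y\<^sub>i\<close> and \<open>u\<^sub>i \<in> Y\<^sub>i\<close>. An elimination step of a word \<open>u\<close> of the
  code preserves the code property, and with \<open>r\<close> the weight of \<open>u\<close> it turns the weight \<open>1\<close> into
  \<open>(1 - r) (1 + r + r\<^sup>2 + \<dots>) = 1\<close>.
\<close>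

section \<open>One elimination step\<close>

text \<open>
  A word \<open>y u\<^sup>j\<close> of \<open>append_star X u\<close> is handled as its factorization \<open>y, u, \<dots>, u\<close> over the old code.
\<close>

definition block :: "'a list \<Rightarrow> 'a list \<times> nat \<Rightarrow> 'a list list" where
  "block u p = fst p # replicate (snd p) u"

lemma append_star_eq_image:
  "append_star X u = (\<lambda>p. concat (block u p)) ` (X \<times> UNIV)"
  by (force simp: append_star_def block_def image_iff)

lemma lists_append_star_blocks:
  assumes "xs \<in> lists (append_star X u)"
  obtains ps where "set ps \<subseteq> X \<times> UNIV" "xs = map (\<lambda>p. concat (block u p)) ps"
  using assms unfolding append_star_eq_image lists_image by (auto simp: lists_eq_set)

lemma concat_map_concat_block:
  "concat (map (\<lambda>p. concat (block u p)) ps) = concat (concat (map (block u) ps))"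
  by (induction ps) auto

lemma blocks_in_lists:
  assumes "set ps \<subseteq> X \<times> UNIV" "X \<subseteq> Y" "u \<in> Y"
  shows "concat (map (block u) ps) \<in> lists Y"
  using assms by (induction ps) (auto simp: block_def)

lemma takeWhile_blocks:
  assumes "set ps \<subseteq> (Y - {u}) \<times> UNIV"
  shows "takeWhile ((=) u) (concat (map (block u) ps)) = []"
  using assms by (cases ps) (auto simp: block_def)

text \<open>Each block begins with a word other than \<open>u\<close>, so the number of leading
  copies of \<open>u\<close>, isolated by \<open>takeWhile\<close>, determines the exponent.\<close>

lemma replicate_blocks_eqD:
  assumes "set ps \<subseteq> (Y - {u}) \<times> UNIV" "set qs \<subseteq> (Y - {u}) \<times> UNIV"
    and eq: "replicate i u @ concat (map (block u) ps) = replicate j u @ concat (map (block u) qs)"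
  shows "i = j \<and> concat (map (block u) ps) = concat (map (block u) qs)"
proof -
  have "takeWhile ((=) u) (replicate l u @ R) = replicate l u"
    if "takeWhile ((=) u) R = []" for l R
    using that by (induction l) auto
  then have "replicate i u = replicate j u"
    using takeWhile_blocks[OF assms(1)] takeWhile_blocks[OF assms(2)] eq by metis
  then have "i = j" by (metis length_replicate)
  with eq show ?thesis by simp
qed

text \<open>Block boundaries can be read off the flattened list: a new block begins exactly at each
  entry other than \<open>u\<close>.\<close>

lemma blocks_inject:
  assumes "set ps \<subseteq> (Y - {u}) \<times> UNIV" "set qs \<subseteq> (Y - {u}) \<times> UNIV"
    and "concat (map (block u) ps) = concat (map (block u) qs)"
  shows "ps = qs"
  using assms
proof (induction ps arbitrary: qs)
  case Nil
  then show ?case by (cases qs) (auto simp: block_def)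
next
  case (Cons p ps)
  then obtain q qs' where qs: "qs = q # qs'"
    by (cases qs) (auto simp: block_def)
  have "fst p = fst q"
    and "replicate (snd p) u @ concat (map (block u) ps) =
         replicate (snd q) u @ concat (map (block u) qs')"
    using Cons.prems(3) qs by (auto simp: block_def[of u p] block_def[of u q])
  moreover have "set ps \<subseteq> (Y - {u}) \<times> UNIV" "set qs' \<subseteq> (Y - {u}) \<times> UNIV"
    using Cons.prems(1,2) qs by auto
  ultimately show ?case
    using Cons.IH replicate_blocks_eqD qs by (metis prod_eqI)
qed

lemma lists_elimination:
  assumes "ys \<in> lists Y"
  obtains j ps where "set ps \<subseteq> (Y - {u}) \<times> UNIV"
    "ys = replicate j u @ concat (map (block u) ps)"
proof -
  from assms have "\<exists>j ps. set ps \<subseteq> (Y - {u}) \<times> UNIV \<and>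
    ys = replicate j u @ concat (map (block u) ps)"
  proof (induction ys)
    case Nil
    show ?case by (rule exI[of _ 0], rule exI[of _ "[]"]) simp
  next
    case (Cons y ys)
    then obtain j ps where jp: "set ps \<subseteq> (Y - {u}) \<times> UNIV"
      "ys = replicate j u @ concat (map (block u) ps)" by auto
    show ?case
    proof (cases "y = u")
      case True
      with jp show ?thesis by (intro exI[of _ "Suc j"] exI[of _ ps]) simp
    next
      case False
      \<comment> \<open>An entry other than \<open>u\<close> absorbs the copies of \<open>u\<close>
        that lead the tail as its exponent.\<close>
      with jp Cons.hyps show ?thesis
        by (intro exI[of _ 0] exI[of _ "(y, j) # ps"]) (auto simp: block_def[of u "(y, j)"])
    qed
  qed
  with that show thesis by blast
qed

section \<open>Codes and weights under one elimination step\<close>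

lemma is_codeD:
  "is_code F \<Longrightarrow> xs \<in> lists F \<Longrightarrow> ys \<in> lists F \<Longrightarrow> concat xs = concat ys \<Longrightarrow> xs = ys"
  by (auto simp: is_code_def)

lemma Nil_notin_code: "is_code F \<Longrightarrow> [] \<notin> F"
  using is_codeD[of F "[[]]" "[]"] by auto

lemma is_code_letters: "is_code {[a] | a. a \<in> A}"
  unfolding is_code_def
proof (intro ballI)
  fix xs ys assume "xs \<in> lists {[a] | a. a \<in> A}" "ys \<in> lists {[a] | a. a \<in> A}"
  then show "concat xs = concat ys \<longrightarrow> xs = ys"
  proof (induction xs arbitrary: ys)
    case Nil
    then show ?case by (cases ys) auto
  next
    case (Cons x xs)
    show ?case using Cons.hyps Cons.prems Cons.IH[of "tl ys"] by (cases ys) auto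
  qed
qed

text \<open>Expanding every word into its block turns both products into factorizations over the
  code \<open>Y\<close>, which must agree; \<open>blocks_inject\<close> then recovers the original
  words.\<close>

lemma is_code_append_star:
  assumes "is_code Y" "u \<in> Y"
  shows "is_code (append_star (Y - {u}) u)"
  unfolding is_code_def
proof (intro ballI impI)
  fix xs ys assume xs: "xs \<in> lists (append_star (Y - {u}) u)"
    and ys: "ys \<in> lists (append_star (Y - {u}) u)" and eq: "concat xs = concat ys"
  obtain ps where ps: "set ps \<subseteq> (Y - {u}) \<times> UNIV" "xs = map (\<lambda>p. concat (block u p)) ps"
    using lists_append_star_blocks[OF xs] .
  obtain qs where qs: "set qs \<subseteq> (Y - {u}) \<times> UNIV" "ys = map (\<lambda>p. concat (block u p)) qs"
    using lists_append_star_blocks[OF ys] .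
  have "concat (map (block u) ps) = concat (map (block u) qs)"
  proof (rule is_codeD[OF assms(1)])
    show "concat (map (block u) ps) \<in> lists Y" "concat (map (block u) qs) \<in> lists Y"
      using blocks_in_lists[of _ "Y - {u}" Y u] ps(1) qs(1) assms(2) by blast+
    show "concat (concat (map (block u) ps)) = concat (concat (map (block u) qs))"
      using eq ps(2) qs(2) by (simp add: concat_map_concat_block)
  qed
  with ps qs show "xs = ys" using blocks_inject by blast
qed

text \<open>This lets the weight of the new code be summed over pairs of a base word and an exponent
  without counting a word twice.\<close>

lemma inj_on_concat_block:
  assumes "is_code Y" "u \<in> Y"
  shows "inj_on (\<lambda>p. concat (block u p)) ((Y - {u}) \<times> UNIV)"
proof (rule inj_onI)
  fix p q assume p: "p \<in> (Y - {u}) \<times> (UNIV :: nat set)" and q: "q \<in> (Y - {u}) \<times> (UNIV :: nat set)"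
    and eq: "concat (block u p) = concat (block u q)"
  have "block u p = block u q"
    by (rule is_codeD[OF assms(1)])
       (use p q eq assms(2) in \<open>auto simp: block_def\<close>)
  then show "p = q"
    using blocks_inject[of "[p]" Y u "[q]"] p q by simp
qed

lemma has_sum_append_star:
  fixes q :: real
  assumes code: "is_code Y" and u: "u \<in> Y" and q: "0 < q" "q < 1"
    and sum: "((\<lambda>y. q ^ length y) has_sum 1) Y"
  shows "((\<lambda>y. q ^ length y) has_sum 1) (append_star (Y - {u}) u)"
proof -
  define r where "r = q ^ length u"
  have "length u > 0"
    using Nil_notin_code[OF code] u by (cases u) auto
  then have r: "0 < r" "r < 1"
    using q by (auto simp: r_def power_less_one_iff)
  have len: "length (concat (block u (y, j))) = length y + j * length u" for y j
    by (simp add: block_def length_concat sum_list_replicate)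
  have "((\<lambda>y. q ^ length y) has_sum (1 - r)) (Y - {u})"
    using has_sum_Diff[OF sum has_sum_finite[of "{u}"]] u by (simp add: r_def)
  then have outer: "((\<lambda>y. q ^ length y * (1 / (1 - r))) has_sum ((1 - r) * (1 / (1 - r)))) (Y - {u})"
    by (rule has_sum_cmult_left)
  have geo: "((\<lambda>j. r ^ j) has_sum (1 / (1 - r))) UNIV"
    using r geometric_sums[of r] by (intro sums_nonneg_imp_has_sum) auto
  have inner: "((\<lambda>j. q ^ length y * r ^ j) has_sum (q ^ length y * (1 / (1 - r)))) UNIV" for y :: "'a list"
    using geo by (rule has_sum_cmult_right)
  \<comment> \<open>The double sum is iterated: first over the exponent, a geometric series by
    \<open>inner\<close>, then over the base word by \<open>outer\<close>.\<close>
  have "((\<lambda>(y, j). q ^ length y * r ^ j) has_sum ((1 - r) * (1 / (1 - r)))) ((Y - {u}) \<times> UNIV)"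
  proof (rule has_sum_SigmaI)
    show "(\<lambda>(y, j). q ^ length y * r ^ j) summable_on (Y - {u}) \<times> UNIV"
      by (rule summable_on_SigmaI[where g = "\<lambda>y. q ^ length y * (1 / (1 - r))"])
         (use inner outer r q in \<open>auto intro: has_sum_imp_summable\<close>)
  qed (use inner outer in auto)
  moreover have "(\<lambda>(y, j). q ^ length y * r ^ j) = (\<lambda>p. q ^ length (concat (block u p)))"
    by (auto simp: len power_add power_mult r_def mult.commute[of _ "length u"])
  ultimately have "((\<lambda>p. q ^ length (concat (block u p))) has_sum 1) ((Y - {u}) \<times> UNIV)"
    using r by simp
  then show ?thesis
    unfolding append_star_eq_image
    using has_sum_reindex[OF inj_on_concat_block[OF code u], of "\<lambda>y. q ^ length y" 1]
    by (simp add: o_def)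
qed


section \<open>Iterated elimination along an increasing sequence\<close>

text \<open>Applied with \<open>x\<close> the word eliminated last: its copies stand at the end,
  since all words eliminated before are smaller.\<close>

lemma sorted_split_greatest:
  fixes x :: "'a :: linorder"
  assumes "sorted vs" "set vs \<subseteq> insert x B" "\<And>b. b \<in> B \<Longrightarrow> b < x"
  obtains vs' j where "vs = vs' @ replicate j x" "sorted vs'" "set vs' \<subseteq> B"
proof -
  from assms have "\<exists>vs' j. vs = vs' @ replicate j x \<and> sorted vs' \<and> set vs' \<subseteq> B"
  proof (induction vs)
    case Nil
    show ?case by (intro exI[of _ "[]"] exI[of _ 0]) simp
  next
    case (Cons a vs)
    then obtain vs' j where *: "vs = vs' @ replicate j x" "sorted vs'" "set vs' \<subseteq> B"
      by auto
    show ?case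
    proof (cases "a \<in> B")
      case True
      with * Cons.prems(1) show ?thesis
        by (intro exI[of _ "a # vs'"] exI[of _ j]) auto
    next
      case False
      with Cons.prems have "a = x" by auto
      moreover have "vs' = []"
        using Cons.prems(1,3) * \<open>a = x\<close> by (cases vs') (auto dest: leD)
      ultimately show ?thesis
        using * by (intro exI[of _ "[]"] exI[of _ "Suc j"]) auto
    qed
  qed
  with that show thesis by blast
qed

text \<open>Nyldon words do not occur here: any increasing sequence of eliminated words is allowed,
  and only its values below \<open>K\<close> are constrained.\<close>

locale right_lazard =
  fixes Z :: "nat \<Rightarrow> 'a :: linorder list set" and v :: "nat \<Rightarrow> 'a list" and K :: nat
  assumes code_0: "is_code (Z 0)"
    and step: "i < K \<Longrightarrow> Z (Suc i) = append_star (Z i - {v i}) (v i)"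
    and mem: "i < K \<Longrightarrow> v i \<in> Z i"
    and mono: "strict_mono_on {..<K} v"
begin

lemma code: "i \<le> K \<Longrightarrow> is_code (Z i)"
  by (induction i) (simp_all add: code_0 step mem is_code_append_star)

text \<open>By induction on \<open>i\<close>: the copies of \<open>v i\<close> that lead
  \<open>xs\<close> exceed all words eliminated before, so they can be moved to the end of the
  sorted part; the rest of \<open>xs\<close> groups into words of the next code.\<close>

lemma factorization_exists:
  assumes "i \<le> K" "ys \<in> lists (Z 0)"
  shows "\<exists>vs xs. sorted vs \<and> set vs \<subseteq> v ` {..<i} \<and> xs \<in> lists (Z i) \<and>
           concat (vs @ xs) = concat ys"
  using assms(1)
proof (induction i)
  case 0
  show ?case by (rule exI[of _ "[]"], rule exI[of _ ys]) (use assms(2) in auto)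
next
  case (Suc i)
  then obtain vs xs where *: "sorted vs" "set vs \<subseteq> v ` {..<i}" "xs \<in> lists (Z i)"
    "concat (vs @ xs) = concat ys" by auto
  obtain j ps where ps: "set ps \<subseteq> (Z i - {v i}) \<times> UNIV"
    "xs = replicate j (v i) @ concat (map (block (v i)) ps)"
    using lists_elimination[OF *(3)] .
  have "x \<le> v i" if "x \<in> set vs" for x
    using that *(2) mono Suc.prems by (auto simp: strict_mono_on_def intro!: less_imp_le)
  then have "sorted (vs @ replicate j (v i))"
    using *(1) by (auto simp: sorted_append)
  moreover have "set (vs @ replicate j (v i)) \<subseteq> v ` {..<Suc i}"
    using *(2) by (auto simp: lessThan_Suc)
  moreover have "map (\<lambda>p. concat (block (v i) p)) ps \<in> lists (Z (Suc i))"
    using ps(1) Suc.prems by (force simp: step append_star_eq_image)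
  moreover have "concat ((vs @ replicate j (v i)) @ map (\<lambda>p. concat (block (v i) p)) ps) = concat ys"
    using *(4) ps(2) by (simp add: concat_map_concat_block)
  ultimately show ?case by blast
qed

text \<open>The last elimination is undone: the copies of \<open>v i\<close> ending the sorted part
  are handed back to the factorization over \<open>Z i\<close>, where the induction hypothesis
  applies.\<close>

lemma factorization_unique:
  assumes "i \<le> K" "sorted vs" "set vs \<subseteq> v ` {..<i}" "xs \<in> lists (Z i)"
    "sorted vs'" "set vs' \<subseteq> v ` {..<i}" "xs' \<in> lists (Z i)"
    "concat (vs @ xs) = concat (vs' @ xs')"
  shows "vs = vs' \<and> xs = xs'"
  using assms
proof (induction i arbitrary: vs xs vs' xs')
  case 0
  then show ?case using is_codeD[OF code_0] by auto
next
  case (Suc i)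
  let ?b = "block (v i)"
  have i: "i < K" using Suc.prems by simp
  have less: "x < v i" if "x \<in> v ` {..<i}" for x
    using that mono i by (auto simp: strict_mono_on_def)
  have sub: "v ` {..<Suc i} = insert (v i) (v ` {..<i})"
    by (auto simp: lessThan_Suc)
  obtain ws j where ws: "vs = ws @ replicate j (v i)" "sorted ws" "set ws \<subseteq> v ` {..<i}"
    using sorted_split_greatest[OF Suc.prems(2) Suc.prems(3)[unfolded sub] less] by blast
  obtain ws' j' where ws': "vs' = ws' @ replicate j' (v i)" "sorted ws'" "set ws' \<subseteq> v ` {..<i}"
    using sorted_split_greatest[OF Suc.prems(5) Suc.prems(6)[unfolded sub] less] by blast
  obtain ps where ps: "set ps \<subseteq> (Z i - {v i}) \<times> UNIV" "xs = map (\<lambda>p. concat (?b p)) ps"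
    using lists_append_star_blocks[OF Suc.prems(4)[unfolded step[OF i]]] .
  obtain ps' where ps': "set ps' \<subseteq> (Z i - {v i}) \<times> UNIV" "xs' = map (\<lambda>p. concat (?b p)) ps'"
    using lists_append_star_blocks[OF Suc.prems(7)[unfolded step[OF i]]] .
  have "ws = ws' \<and> replicate j (v i) @ concat (map ?b ps) = replicate j' (v i) @ concat (map ?b ps')"
  proof (rule Suc.IH)
    have "concat (map ?b ps) \<in> lists (Z i)" "concat (map ?b ps') \<in> lists (Z i)"
      using blocks_in_lists[of _ "Z i - {v i}" "Z i" "v i"] ps(1) ps'(1) mem[OF i] by blast+
    then show "replicate j (v i) @ concat (map ?b ps) \<in> lists (Z i)"
      "replicate j' (v i) @ concat (map ?b ps') \<in> lists (Z i)"
      using mem[OF i] by (auto simp del: set_concat)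
    show "concat (ws @ replicate j (v i) @ concat (map ?b ps)) =
      concat (ws' @ replicate j' (v i) @ concat (map ?b ps'))"
      using Suc.prems(8) ws(1) ws'(1) ps(2) ps'(2) by (simp add: concat_map_concat_block)
  qed (use i ws ws' in auto)
  moreover from this have "j = j' \<and> ps = ps'"
    using replicate_blocks_eqD[OF ps(1) ps'(1)] blocks_inject[OF ps(1) ps'(1)] by blast
  ultimately show ?case using ws(1) ws'(1) ps(2) ps'(2) by simp
qed

text \<open>The word \<open>w\<close> has exactly one nondecreasing factorization into eliminated
  words. If there are at least two nonempty factors, they are shorter than \<open>w\<close>, so by
  induction on the length being Nyldon and being eliminated agree for them.\<close>

lemma nyldon_iff_eliminated:
  assumes Z0: "Z 0 = {[a] | a. a \<in> A}" and long: "\<And>y. y \<in> Z K \<Longrightarrow> n < length y"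
    and "w \<in> lists A" "length w \<le> n"
  shows "nyldon w \<longleftrightarrow> w \<in> v ` {..<K}"
  using assms(3,4)
proof (induction w rule: length_induct)
  case (1 w)
  let ?V = "v ` {..<K}"
  have V_ne: "x \<noteq> []" if "x \<in> ?V" for x
    using that mem code Nil_notin_code by (metis imageE lessThan_iff less_imp_le)
  have part: "length x < length w \<and> x \<in> lists A"
    if ws: "concat ws = w" "length ws \<ge> 2" "x \<in> set ws" "\<And>y. y \<in> set ws \<Longrightarrow> y \<noteq> []" for ws x
  proof -
    obtain xs ys where split: "ws = xs @ x # ys"
      using split_list[OF ws(3)] by blast
    then obtain y where "y \<in> set xs \<union> set ys"
      using ws(2) by (cases xs; cases ys) auto
    with ws(4) split have "concat xs \<noteq> [] \<or> concat ys \<noteq> []" by auto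
    then have "length x < length w"
      using ws(1) split by (auto simp flip: length_greater_0_conv)
    moreover have "x \<in> lists A"
      using ws(1) split "1.prems"(1) by auto
    ultimately show ?thesis by blast
  qed
  have same: "nyldon x \<longleftrightarrow> x \<in> ?V"
    if "concat ws = w" "length ws \<ge> 2" "x \<in> set ws" "\<And>y. y \<in> set ws \<Longrightarrow> y \<noteq> []" for ws x
    using part[OF that] "1.IH" "1.prems" by auto
  have ny_ne: "x \<noteq> []" if "nyldon x" for x :: "'a list"
    using that nyldon_iff by blast
  obtain vs xs where vs: "sorted vs" "set vs \<subseteq> ?V" "xs \<in> lists (Z K)" "concat (vs @ xs) = w"
  proof -
    have "map (\<lambda>a. [a]) w \<in> lists (Z 0)" using "1.prems"(1) Z0 by auto
    from factorization_exists[OF order_refl this] that show thesis by auto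
  qed
  \<comment> \<open>Words of \<open>Z K\<close> are longer than \<open>n\<close>, hence too long to
    be factors of \<open>w\<close>.\<close>
  have "xs = []"
  proof (rule ccontr)
    assume "xs \<noteq> []"
    then obtain x where "x \<in> set xs" by (cases xs) auto
    then have "length x \<le> length w"
      using vs(4) by (auto simp: length_concat dest!: split_list)
    moreover have "n < length x" using \<open>x \<in> set xs\<close> vs(3) long by auto
    ultimately show False using "1.prems"(2) by simp
  qed
  with vs have w: "concat vs = w" by simp
  show ?case
  proof
    assume ny: "nyldon w"
    show "w \<in> ?V"
    \<comment> \<open>Two or more factors would all be Nyldon, leaving only
      \<open>length w = 1\<close>, which has no room for a shorter nonempty factor.\<close>
    proof (cases "length vs \<ge> 2")
      case True
      have "\<forall>x\<in>set vs. nyldon x"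
        using same[OF w True] vs(2) V_ne by blast
      with ny True vs(1) w have "length w = 1"
        using nyldon_iff[of w] by blast
      moreover obtain x where x: "x \<in> set vs" using True by (cases vs) auto
      moreover have "length x < length w"
        using part[OF w True x] vs(2) V_ne by blast
      moreover have "x \<noteq> []" using V_ne vs(2) x by blast
      ultimately show ?thesis by simp
    next
      case False
      moreover have "vs \<noteq> []" using ny_ne[OF ny] w by auto
      ultimately obtain x where "vs = [x]" by (cases vs rule: remdups_adj.cases) auto
      with w vs(2) show ?thesis by simp
    qed
  next
    assume wV: "w \<in> ?V"
    have "\<not> (\<exists>ws. length ws \<ge> 2 \<and> concat ws = w \<and> (\<forall>x\<in>set ws. nyldon x) \<and> sorted ws)"
    proof
      assume "\<exists>ws. length ws \<ge> 2 \<and> concat ws = w \<and> (\<forall>x\<in>set ws. nyldon x) \<and> sorted ws"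
      then obtain ws where ws: "length ws \<ge> 2" "concat ws = w" "\<forall>x\<in>set ws. nyldon x" "sorted ws"
        by blast
      then have "set ws \<subseteq> ?V" using same[OF ws(2,1)] ny_ne by blast
      \<comment> \<open>Both \<open>ws\<close> and \<open>[w]\<close> are nondecreasing
        factorizations of \<open>w\<close> into eliminated words.\<close>
      then have "ws = [w]"
        using factorization_unique[of K ws "[]" "[w]" "[]"] ws wV by simp
      with ws(1) show False by simp
    qed
    then show "nyldon w" using nyldon_iff V_ne[OF wV] by blast
  qed
qed

end

section \<open>Always eliminating the least short word\<close>

text \<open>The recursion itself never stops. Once no word of length at most \<open>n\<close> is
  left, \<open>Min\<close> is taken of the empty set and is unspecified, so only the stages up to
  that point are meaningful.\<close>

primrec greedy :: "nat \<Rightarrow> 'a :: linorder set \<Rightarrow> nat \<Rightarrow> 'a list set" where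
  "greedy n A 0 = {[a] | a. a \<in> A}"
| "greedy n A (Suc i) =
     (let u = Min {y \<in> greedy n A i. length y \<le> n} in append_star (greedy n A i - {u}) u)"

definition greedy_min :: "nat \<Rightarrow> 'a :: linorder set \<Rightarrow> nat \<Rightarrow> 'a list" where
  "greedy_min n A i = Min {y \<in> greedy n A i. length y \<le> n}"

lemma le_append_lexorder: "(xs :: 'a :: linorder list) \<le> xs @ ys"
  by (induction xs) auto

lemma append_star_eq: "append_star X u = {x @ concat (replicate j u) | x j. x \<in> X}"
  by (auto simp: append_star_def)

lemma greedy_right_lazard:
  fixes A :: "'a :: linorder set"
  assumes "finite A"
  obtains K where "right_lazard (greedy n A) (greedy_min n A) K"
    "\<And>y. y \<in> greedy n A K \<Longrightarrow> n < length y"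
    "\<And>i. i < K \<Longrightarrow> length (greedy_min n A i) \<le> n \<and> greedy_min n A i \<in> lists A"
proof -
  let ?v = "greedy_min n A"
  define S where "S i = {y \<in> greedy n A i. length y \<le> n}" for i
  have step: "greedy n A (Suc i) = append_star (greedy n A i - {?v i}) (?v i)" for i
    by (simp add: greedy_min_def Let_def)
  have fin_words: "finite {w. set w \<subseteq> A \<and> length w \<le> n}"
    using finite_lists_length_le[OF assms] .
  have good: "S i \<noteq> {} \<Longrightarrow> ?v i \<in> S i \<and> (\<forall>y\<in>S i. ?v i \<le> y)" 
    if "greedy n A i \<subseteq> lists A" for i
  proof -
    have "finite (S i)"
      by (rule finite_subset[OF _ fin_words]) (use that in \<open>auto simp: S_def\<close>)
    then show "S i \<noteq> {} \<Longrightarrow> ?v i \<in> S i \<and> (\<forall>y\<in>S i. ?v i \<le> y)"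
      unfolding greedy_min_def S_def[symmetric] using Min_in Min_le by blast
  qed
  \<comment> \<open>The earlier stages must be nonempty, since \<open>Min\<close> of the empty set
    could lie outside \<open>lists A\<close>.\<close>
  have words: "greedy n A i \<subseteq> lists A" if "\<And>j. j < i \<Longrightarrow> S j \<noteq> {}" for i
    using that
  proof (induction i)
    case (Suc i)
    then have sub: "greedy n A i \<subseteq> lists A" by simp
    then have "?v i \<in> lists A" using good[OF sub] Suc.prems[of i] by (auto simp: S_def)
    with sub show ?case unfolding step append_star_eq by fastforce
  qed auto
  have min: "?v i \<in> S i \<and> (\<forall>y\<in>S i. ?v i \<le> y)" if "\<And>j. j \<le> i \<Longrightarrow> S j \<noteq> {}" for i
    using good[OF words] that by simp
  \<comment> \<open>The next minimum is some remaining \<open>x\<close> followed by copies of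
    \<open>?v i\<close>. As a prefix of a short word \<open>x\<close> is short too, so it already
    competed with \<open>?v i\<close> and lost.\<close>
  have incr: "?v i < ?v (Suc i)" if "\<And>j. j \<le> Suc i \<Longrightarrow> S j \<noteq> {}" for i
  proof -
    have "?v (Suc i) \<in> S (Suc i)" using min that by blast
    then obtain x j where x: "x \<in> greedy n A i" "x \<noteq> ?v i" "length (?v (Suc i)) \<le> n"
      and eq: "?v (Suc i) = x @ concat (replicate j (?v i))"
      unfolding S_def step append_star_eq by blast
    then have "x \<in> S i" by (auto simp: S_def)
    then have "?v i < x" using min[of i] that x(2) by (simp add: order_less_le)
    also have "x \<le> ?v (Suc i)" unfolding eq by (rule le_append_lexorder)
    finally show ?thesis .
  qed
  have mono: "?v i < ?v j" if "i < j" "\<And>l. l \<le> j \<Longrightarrow> S l \<noteq> {}" for i j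
    using that
  proof (induction j)
    case (Suc j)
    then have "?v j < ?v (Suc j)" using incr by blast
    with Suc show ?case by (cases "i = j") (auto intro: less_trans)
  qed simp
  \<comment> \<open>Otherwise infinitely many distinct words over the finite alphabet would have
    length at most \<open>n\<close>.\<close>
  have "\<exists>i. S i = {}"
  proof (rule ccontr)
    assume "\<nexists>i. S i = {}"
    then have ne: "S i \<noteq> {}" for i by blast
    then have "strict_mono ?v" using mono by (auto simp: strict_mono_def)
    then have "infinite (range ?v)"
      by (intro range_inj_infinite strict_mono_imp_inj_on)
    moreover have "?v i \<in> {w. set w \<subseteq> A \<and> length w \<le> n}" for i
      using min[of i] words[of i] ne by (auto simp: S_def)
    then have "finite (range ?v)" by (intro finite_subset[OF _ fin_words] image_subsetI)
    ultimately show False by simp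
  qed
  \<comment> \<open>Taking the least such index keeps all earlier \<open>S i\<close> nonempty, so
    every \<open>?v i\<close> with \<open>i < K\<close> is a genuine minimum.\<close>
  define K where "K = (LEAST i. S i = {})"
  have SK: "S K = {}" unfolding K_def using \<open>\<exists>i. S i = {}\<close> by (rule LeastI_ex)
  have ne: "S i \<noteq> {}" if "i < K" for i
    using that not_less_Least unfolding K_def by blast
  have v: "?v i \<in> S i" if "i < K" for i using min ne that by simp
  show thesis
  proof (rule that)
    show "right_lazard (greedy n A) ?v K"
    proof
      show "?v i \<in> greedy n A i" if "i < K" for i using v[OF that] by (simp add: S_def)
      show "strict_mono_on {..<K} ?v" using mono ne by (auto simp: strict_mono_on_def)
    qed (use is_code_letters step in auto)
    show "n < length y" if "y \<in> greedy n A K" for y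
      using SK that by (force simp: S_def)
    show "length (?v i) \<le> n \<and> ?v i \<in> lists A" if "i < K" for i
      using v[OF that] words[of i] ne that by (auto simp: S_def)
  qed
qed

section \<open>Identification of the greedy procedure with the given sequences\<close>

theorem theorem6p9:
  fixes m n k :: nat
    and u :: "nat \<Rightarrow> nat list"
    and Y :: "nat \<Rightarrow> nat list set"
  assumes "m \<ge> 1" and "n \<ge> 1"
    and "strict_mono_on {1..k} u"
    and "u ` {1..k} = {w \<in> lists {0..m}. nyldon w \<and> length w \<le> n}"
    and "Y 1 = {[a] | a. a \<in> {0..m}}"
    and "\<And>i. i \<in> {2..k} \<Longrightarrow> Y i = append_star (Y (i - 1) - {u (i - 1)}) (u (i - 1))"
  shows "\<forall>i\<in>{1..k}. is_code (Y i) \<and>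
           ((\<lambda>y. (real m + 1) powi (- int (length y))) has_sum 1) (Y i)"
proof -
  let ?Z = "greedy n {0..m}" and ?v = "greedy_min n {0..m}"
  obtain K where rl: "right_lazard ?Z ?v K"
    and long: "\<And>y. y \<in> ?Z K \<Longrightarrow> n < length y"
    and short: "\<And>i. i < K \<Longrightarrow> length (?v i) \<le> n \<and> ?v i \<in> lists {0..m}"
    using greedy_right_lazard[of "{0..m}" n] by auto
  interpret right_lazard ?Z ?v K by (rule rl)
  have "?v ` {..<K} = {w \<in> lists {0..m}. nyldon w \<and> length w \<le> n}"
    using nyldon_iff_eliminated[of "{0..m}" n, OF _ long] short by auto
  then have img: "u ` {1..k} = ?v ` {..<K}" using assms(4) by simp
  \<comment> \<open>Two increasing enumerations of the same finite set coincide, which also gives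
    \<open>k = K\<close>. The \<open>Suc\<close> aligns \<open>u\<close>, indexed from 1, with
    \<open>?v\<close>, indexed from 0.\<close>
  have "map (\<lambda>i. u (Suc i)) [0..<k] = map ?v [0..<K]"
  proof (rule sorted_distinct_set_unique)
    have u: "u (Suc i) < u (Suc j)" if "i < j" "j < k" for i j
      using assms(3) that by (auto simp: strict_mono_on_def)
    have v: "?v i < ?v j" if "i < j" "j < K" for i j
      using mono that by (auto simp: strict_mono_on_def)
    show "sorted (map (\<lambda>i. u (Suc i)) [0..<k])" "sorted (map ?v [0..<K])"
      using u v by (auto simp: sorted_iff_nth_mono_less less_imp_le)
    show "distinct (map (\<lambda>i. u (Suc i)) [0..<k])" "distinct (map ?v [0..<K])"
      using u v by (auto simp: distinct_map inj_on_def) (metis less_irrefl linorder_neqE_nat)+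
    have "u ` {1..k} = (\<lambda>i. u (Suc i)) ` {0..<k}"
      by (simp add: image_image[symmetric, of u Suc] image_Suc_atLeastLessThan
        atLeastLessThanSuc_atLeastAtMost)
    with img show "set (map (\<lambda>i. u (Suc i)) [0..<k]) = set (map ?v [0..<K])"
      by (simp add: lessThan_atLeast0)
  qed
  then have k: "k = K" and uv: "\<And>i. i < k \<Longrightarrow> u (Suc i) = ?v i"
    by (auto dest: map_eq_imp_length_eq simp: list_eq_iff_nth_eq)
  have YZ: "Y (Suc i) = ?Z i" if "i < k" for i
    using that
  proof (induction i)
    case 0
    then show ?case using assms(5) by simp
  next
    case (Suc i)
    then show ?case using assms(6)[of "Suc (Suc i)"] uv[of i] step[of i] k by simp
  qed
  define q where "q = 1 / (real m + 1)"
  have q: "0 < q" "q < 1" using assms(1) by (auto simp: q_def)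
  have powi: "(real m + 1) powi (- int l) = q ^ l" for l
    by (simp add: q_def power_int_minus power_one_over inverse_eq_divide)
  have sum: "((\<lambda>y. q ^ length y) has_sum 1) (?Z i)" if "i \<le> K" for i
    using that
  proof (induction i)
    \<comment> \<open>The initial code consists of \<open>m + 1\<close> letters, each of weight
      \<open>q\<close>.\<close>
    case 0
    have "((\<lambda>y. q ^ length y) has_sum (\<Sum>y\<in>(\<lambda>a. [a]) ` {0..m}. q ^ length y)) ((\<lambda>a. [a]) ` {0..m})"
      by (rule has_sum_finite) simp
    moreover have "(\<Sum>y\<in>(\<lambda>a. [a]) ` {0..m}. q ^ length y) = 1"
      by (subst sum.reindex) (auto simp: inj_on_def q_def field_simps)
    moreover have "(\<lambda>a. [a]) ` {0..m} = ?Z 0" by auto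
    ultimately show ?case by (simp only:)
  next
    case (Suc i)
    then show ?case
      using has_sum_append_star[OF code[of i] mem[of i] q] step[of i] by (simp del: greedy.simps)
  qed
  show ?thesis
  proof
    fix i assume "i \<in> {1..k}"
    then obtain j where "i = Suc j" "j < k" by (cases i) auto
    then show "is_code (Y i) \<and> ((\<lambda>y. (real m + 1) powi (- int (length y))) has_sum 1) (Y i)"
      using YZ[of j] code[of j] sum[of j] k by (simp add: powi del: greedy.simps)
  qed
qed

end
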